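(* Let $S$ be a regular semigroup. Then $R(S)$ is a regular semiband of depth 2 and the mapping $\varphi:S\to R(S)$, $s\mapsto(s,s,\sigma)$, embeds $S$ into $R(S)$. Further, $$\mathcal{K}^{T(S)}\cap R(S)=\mathcal{K}^{R(S)}\quad\text{and}\quad \leq^{T(S)}\cap\, R(S)=\ \leq^{R(S)}$$ for each Green's relation $\mathcal{K}\in\{\mathcal{H},\mathcal{L},\mathcal{R},\mathcal{D},\mathcal{J}\}$.
   Context: For a semigroup $A$, $E(A)$ denotes its set of idempotents, and $A^1$ denotes $A$ itself if $A$ is a monoid, and otherwise $A$ with an extra identity element $1$ adjoined. A semiband is a semigroup generated by its idempotents. For $n\geq 1$ let $E(A)^n$ denote the set of elements of $A$ that are products of $n$ idempotents, and let $E(A)^0=\emptyset$; a semiband $A$ has depth $k$ if $E(A)^{k-1}\neq E(A)^k=E(A)^{k+1}$. Let $R_2=\{\sigma,\tau\}$ be the two-element right-zero semigroup, and let $T*R_2$ be the set $S\times S\times R_2$ with product $(t_1,s_1,\sigma)(t_2,s_2,\alpha_2)=(t_1s_2,\,s_1s_2,\,\alpha_2)$ and $(t_1,s_1,\tau)(t_2,s_2,\alpha_2)=(t_1t_2,\,s_1t_2,\,\alpha_2)$ (a semidirect product of $T=S\times S$ by $R_2$). Let $E=\{(s,t,\alpha)\in E(T*R_2):\ s\in S^1t\}$ and let $T(S)=\langle E\rangle$ be the subsemigroup generated by $E$; for $S$ regular one has $T(S)=\{(s,t,\alpha)\in T*R_2:\ s\in S^1t\}$. Let $R(S)=\{(s,t,\alpha)\in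 T(S):\ s\,\mathcal{L}\,t \text{ in } S\}$, a subsemigroup of $T(S)$. The natural partial order $\leq$ on a semigroup $A$ is defined by: $s\leq t$ if and only if $s=at=tb=sb$ for some $a,b\in A$. A superscript on a relation indicates the semigroup on which it is taken, and the intersection of a relation on $T(S)$ with $R(S)$ means its restriction to $R(S)$, i.e. its intersection with $R(S)\times R(S)$.
   Formalization: The claim that R(S) has depth 2 fails when S is a band (e.g. the one-element semigroup, where R(S) is a right-zero band of depth 1); the formal theorem asserts depth 2 when S is not a band and depth 1 when it is. *)

theory Defs
  imports Main
begin

section \<open>Semigroups on a carrier set\<close>

record 'a smg =
  carrier :: "'a set"
  mult :: "'a \<Rightarrow> 'a \<Rightarrow> 'a" (infixl \<open>\<cdot>\<index>\<close> 70)

text \<open>Semigroups are nonempty, as usual.\<close>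

definition semigrp :: "'a smg \<Rightarrow> bool" where
  "semigrp A \<longleftrightarrow> carrier A \<noteq> {} \<and>
     (\<forall>x\<in>carrier A. \<forall>y\<in>carrier A. x \<cdot>\<^bsub>A\<^esub> y \<in> carrier A) \<and>
     (\<forall>x\<in>carrier A. \<forall>y\<in>carrier A. \<forall>z\<in>carrier A. (x \<cdot>\<^bsub>A\<^esub> y) \<cdot>\<^bsub>A\<^esub> z = x \<cdot>\<^bsub>A\<^esub> (y \<cdot>\<^bsub>A\<^esub> z))"

definition regular_semigrp :: "'a smg \<Rightarrow> bool" where
  "regular_semigrp A \<longleftrightarrow> semigrp A \<and>
     (\<forall>x\<in>carrier A. \<exists>y\<in>carrier A. x \<cdot>\<^bsub>A\<^esub> y \<cdot>\<^bsub>A\<^esub> x = x)"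

definition has_identity :: "'a smg \<Rightarrow> bool" where
  "has_identity A \<longleftrightarrow>
     (\<exists>e\<in>carrier A. \<forall>x\<in>carrier A. e \<cdot>\<^bsub>A\<^esub> x = x \<and> x \<cdot>\<^bsub>A\<^esub> e = x)"

text \<open>The semigroup \<open>A\<^sup>1\<close>: an element \<open>x\<close> of \<open>A\<close> becomes \<open>Some x\<close>, and \<open>None\<close> is the
  extra identity, present only if \<open>A\<close> is not a monoid.\<close>

definition adjoin_one :: "'a smg \<Rightarrow> 'a option smg" where
  "adjoin_one A =
     \<lparr>carrier = (if has_identity A then Some ` carrier A else insert None (Some ` carrier A)),
      mult = (\<lambda>p q. case p of None \<Rightarrow> q
                | Some x \<Rightarrow> (case q of None \<Rightarrow> p | Some y \<Rightarrow> Some (x \<cdot>\<^bsub>A\<^esub> y)))\<rparr>"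

text \<open>The principal ideals \<open>A\<^sup>1 x\<close>, \<open>x A\<^sup>1\<close> and \<open>A\<^sup>1 x A\<^sup>1\<close>, as subsets of \<open>A\<close>.\<close>

definition left_ideal :: "'a smg \<Rightarrow> 'a \<Rightarrow> 'a set" where
  "left_ideal A x =
     {y. \<exists>p\<in>carrier (adjoin_one A). Some y = p \<cdot>\<^bsub>adjoin_one A\<^esub> Some x}"

definition right_ideal :: "'a smg \<Rightarrow> 'a \<Rightarrow> 'a set" where
  "right_ideal A x =
     {y. \<exists>q\<in>carrier (adjoin_one A). Some y = Some x \<cdot>\<^bsub>adjoin_one A\<^esub> q}"

definition two_sided_ideal :: "'a smg \<Rightarrow> 'a \<Rightarrow> 'a set" where
  "two_sided_ideal A x =
     {y. \<exists>p\<in>carrier (adjoin_one A). \<exists>q\<in>carrier (adjoin_one A).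
           Some y = p \<cdot>\<^bsub>adjoin_one A\<^esub> Some x \<cdot>\<^bsub>adjoin_one A\<^esub> q}"

definition green_L :: "'a smg \<Rightarrow> 'a rel" where
  "green_L A = {(x, y) \<in> carrier A \<times> carrier A. left_ideal A x = left_ideal A y}"

definition green_R :: "'a smg \<Rightarrow> 'a rel" where
  "green_R A = {(x, y) \<in> carrier A \<times> carrier A. right_ideal A x = right_ideal A y}"

definition green_J :: "'a smg \<Rightarrow> 'a rel" where
  "green_J A = {(x, y) \<in> carrier A \<times> carrier A. two_sided_ideal A x = two_sided_ideal A y}"

definition green_H :: "'a smg \<Rightarrow> 'a rel" where
  "green_H A = green_L A \<inter> green_R A"

definition green_D :: "'a smg \<Rightarrow> 'a rel" where
  "green_D A = green_L A O green_R A"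

definition natural_order :: "'a smg \<Rightarrow> 'a rel" where
  "natural_order A = {(s, t) \<in> carrier A \<times> carrier A.
     \<exists>a\<in>carrier A. \<exists>b\<in>carrier A. s = a \<cdot>\<^bsub>A\<^esub> t \<and> s = t \<cdot>\<^bsub>A\<^esub> b \<and> s = s \<cdot>\<^bsub>A\<^esub> b}"

definition idems :: "'a smg \<Rightarrow> 'a set" where
  "idems A = {x \<in> carrier A. x \<cdot>\<^bsub>A\<^esub> x = x}"

definition band :: "'a smg \<Rightarrow> bool" where
  "band A \<longleftrightarrow> semigrp A \<and> idems A = carrier A"

inductive_set generated :: "'a smg \<Rightarrow> 'a set \<Rightarrow> 'a set" for A X where
  incl: "x \<in> X \<Longrightarrow> x \<in> generated A X"
| prod: "x \<in> generated A X \<Longrightarrow> y \<in> generated A X \<Longrightarrow> x \<cdot>\<^bsub>A\<^esub> y \<in> generated A X"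

definition semiband :: "'a smg \<Rightarrow> bool" where
  "semiband A \<longleftrightarrow> semigrp A \<and> generated A (idems A) = carrier A"

fun idem_prods :: "'a smg \<Rightarrow> nat \<Rightarrow> 'a set" where
  "idem_prods A 0 = {}"
| "idem_prods A (Suc 0) = idems A"
| "idem_prods A (Suc (Suc n)) = {x \<cdot>\<^bsub>A\<^esub> y | x y. x \<in> idem_prods A (Suc n) \<and> y \<in> idems A}"

text \<open>For \<open>k = 0\<close> truncated subtraction makes this false, so a depth is always positive.\<close>

definition has_depth :: "'a smg \<Rightarrow> nat \<Rightarrow> bool" where
  "has_depth A k \<longleftrightarrow> semiband A \<and>
     idem_prods A (k - 1) \<noteq> idem_prods A k \<and> idem_prods A k = idem_prods A (k + 1)"

definition smg_embedding :: "('a \<Rightarrow> 'b) \<Rightarrow> 'a smg \<Rightarrow> 'b smg \<Rightarrow> bool" where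
  "smg_embedding f A B \<longleftrightarrow> f ` carrier A \<subseteq> carrier B \<and> inj_on f (carrier A) \<and>
     (\<forall>x\<in>carrier A. \<forall>y\<in>carrier A. f (x \<cdot>\<^bsub>A\<^esub> y) = f x \<cdot>\<^bsub>B\<^esub> f y)"

section \<open>The semigroups \<open>T * R\<^sub>2\<close>, \<open>T(S)\<close> and \<open>R(S)\<close>\<close>

datatype R2 = sigma | tau

text \<open>The third component multiplies as in the right-zero semigroup on \<open>R2\<close>.\<close>

fun TR2_mult :: "'a smg \<Rightarrow> 'a \<times> 'a \<times> R2 \<Rightarrow> 'a \<times> 'a \<times> R2 \<Rightarrow> 'a \<times> 'a \<times> R2" where
  "TR2_mult S (t1, s1, sigma) (t2, s2, \<alpha>2) = (t1 \<cdot>\<^bsub>S\<^esub> s2, s1 \<cdot>\<^bsub>S\<^esub> s2, \<alpha>2)"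
| "TR2_mult S (t1, s1, tau) (t2, s2, \<alpha>2) = (t1 \<cdot>\<^bsub>S\<^esub> t2, s1 \<cdot>\<^bsub>S\<^esub> t2, \<alpha>2)"

definition TR2 :: "'a smg \<Rightarrow> ('a \<times> 'a \<times> R2) smg" where
  "TR2 S = \<lparr>carrier = carrier S \<times> carrier S \<times> UNIV, mult = TR2_mult S\<rparr>"

definition T_gens :: "'a smg \<Rightarrow> ('a \<times> 'a \<times> R2) set" where
  "T_gens S = {(s, t, \<alpha>) \<in> idems (TR2 S). s \<in> left_ideal S t}"

definition T_smg :: "'a smg \<Rightarrow> ('a \<times> 'a \<times> R2) smg" where
  "T_smg S = \<lparr>carrier = generated (TR2 S) (T_gens S), mult = TR2_mult S\<rparr>"

definition R_smg :: "'a smg \<Rightarrow> ('a \<times> 'a \<times> R2) smg" where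
  "R_smg S = \<lparr>carrier = {(s, t, \<alpha>) \<in> carrier (T_smg S). (s, t) \<in> green_L S}, mult = TR2_mult S\<rparr>"

text \<open>If every element of \<open>S\<close> is idempotent then so is every element of \<open>R(S)\<close>, and then \<open>R(S)\<close>
  cannot have depth 2 in the sense of \<^const>\<open>has_depth\<close>. Hence a claim that \<open>R(S)\<close> has depth 2
  must leave out bands \<open>S\<close>.\<close>

lemma green_L_band_right:
  assumes "band S" "(s, t) \<in> green_L S"
  shows "s \<cdot>\<^bsub>S\<^esub> t = s"
proof -
  have S: "semigrp S" and I: "idems S = carrier S" using assms(1) by (auto simp: band_def)
  have st: "s \<in> carrier S" "t \<in> carrier S" and eq: "left_ideal S s = left_ideal S t"
    using assms(2) by (auto simp: green_L_def)
  have idem: "x \<cdot>\<^bsub>S\<^esub> x = x" if "x \<in> carrier S" for x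
    using I that by (auto simp: idems_def)
  have "s \<in> left_ideal S s"
    unfolding left_ideal_def using st idem[of s]
    by (intro CollectI bexI[of _ "Some s"]) (simp_all add: adjoin_one_def)
  then have "s \<in> left_ideal S t" using eq by simp
  then consider "s = t" | a where "a \<in> carrier S" "s = a \<cdot>\<^bsub>S\<^esub> t"
    by (auto simp: left_ideal_def adjoin_one_def split: if_splits)
  then show ?thesis
  proof cases
    case 1
    then show ?thesis using idem st by simp
  next
    case 2
    have "a \<cdot>\<^bsub>S\<^esub> t \<cdot>\<^bsub>S\<^esub> t = a \<cdot>\<^bsub>S\<^esub> (t \<cdot>\<^bsub>S\<^esub> t)" using S 2 st unfolding semigrp_def by blast
    then show ?thesis using 2 idem st by simp
  qed
qed

lemma R_smg_band_not_depth_2: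
  assumes "band S"
  shows "\<not> has_depth (R_smg S) 2"
proof
  let ?R = "R_smg S"
  assume d: "has_depth ?R 2"
  have idem: "x \<cdot>\<^bsub>S\<^esub> x = x" if "x \<in> carrier S" for x
    using assms that by (auto simp: idems_def band_def)
  have x: "x \<cdot>\<^bsub>?R\<^esub> x = x" if "x \<in> carrier ?R" for x
  proof -
    obtain s t \<alpha> where [simp]: "x = (s, t, \<alpha>)" by (cases x)
    have L: "(s, t) \<in> green_L S" "(t, s) \<in> green_L S"
      using that by (auto simp: R_smg_def green_L_def)
    then have "s \<in> carrier S" "t \<in> carrier S" by (auto simp: green_L_def)
    then show ?thesis
      using green_L_band_right[OF assms L(1)] green_L_band_right[OF assms L(2)] idem
      by (cases \<alpha>) (auto simp: R_smg_def)
  qed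
  then have I: "idems ?R = carrier ?R" by (auto simp: idems_def)
  have cl: "y \<cdot>\<^bsub>?R\<^esub> z \<in> carrier ?R" if "y \<in> carrier ?R" "z \<in> carrier ?R" for y z
    using d that unfolding has_depth_def semiband_def semigrp_def by blast
  have "{y \<cdot>\<^bsub>?R\<^esub> z | y z. y \<in> carrier ?R \<and> z \<in> carrier ?R} = carrier ?R" (is "?P = _")
  proof
    show "?P \<subseteq> carrier ?R" using cl by blast
    show "carrier ?R \<subseteq> ?P" using x by (smt (verit) mem_Collect_eq subsetI)
  qed
  then show False using d I by (simp add: has_depth_def numeral_2_eq_2)
qed

end

theory Submission
  imports Defs
begin

text \<open>
  Two facts about \<open>R(S)\<close> carry the proof.

  The first is that \<open>R(S)\<close> is a regular right ideal of \<open>T(S)\<close>. A product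
  \<open>(s, t, \<alpha>) (u, v, \<beta>)\<close> is \<open>(s w, t w, \<beta>)\<close>, where \<open>w\<close> is \<open>v\<close> or \<open>u\<close> according to \<open>\<alpha>\<close>, and
  \<open>\<L>\<close> is a right congruence; this gives the right ideal. An inverse of \<open>t\<close> (if \<open>\<alpha> = \<sigma>\<close>) or of
  \<open>s\<close> (if \<open>\<alpha> = \<tau>\<close>) on the diagonal inverts \<open>(s, t, \<alpha>)\<close>. All the claims on Green's relations and on the
  natural order hold for every regular right ideal \<open>B\<close> of a semigroup \<open>A\<close>. If \<open>x = p y\<close> with
  \<open>x, y\<close> in \<open>B\<close> and \<open>y y' y = y\<close>, then \<open>x = (x y') y\<close>, so the multiplier can be moved into \<open>B\<close>; dually on
  the other side, and similarly for the natural order. This settles \<open>\<L>\<close>, \<open>\<R>\<close>, \<open>\<H>\<close> and the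
  order for every regular subsemigroup. For \<open>\<D>\<close> and \<open>\<J>\<close> there is also an intermediate
  element, and it can be chosen in \<open>y A\<^sup>1\<close>, hence in \<open>B\<close> because \<open>B\<close> is a right ideal.

  The second is that each triple \<open>(s, t, \<alpha>)\<close> with \<open>s \<L> t\<close> is a product of two idempotents
  whose first two components are \<open>\<L>\<close>-related. With inverses \<open>s'\<close> and \<open>t'\<close>,
  \<open>(s, t, \<sigma>) = (s s', t s', \<tau>) (s, s' s, \<sigma>)\<close> and
  \<open>(s, t, \<tau>) = (s t', t t', \<sigma>) (t' t, t, \<tau>)\<close>.
  The four idempotents are generators of \<open>T(S)\<close> and lie in \<open>R(S)\<close>.
  So \<open>R(S)\<close> consists of all triples with \<open>s \<L> t\<close>, and it is a semiband of depth at most 2. The diagonal copy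
  of \<open>S\<close> contains an element that is not idempotent unless \<open>S\<close> is a band, and in that case
  every element of \<open>R(S)\<close> is idempotent.
\<close>

section \<open>Principal ideals and Green's relations\<close>

lemma semigrp_closed:
  "semigrp A \<Longrightarrow> x \<in> carrier A \<Longrightarrow> y \<in> carrier A \<Longrightarrow> x \<cdot>\<^bsub>A\<^esub> y \<in> carrier A"
  unfolding semigrp_def by blast

lemma semigrp_assoc:
  "semigrp A \<Longrightarrow> x \<in> carrier A \<Longrightarrow> y \<in> carrier A \<Longrightarrow> z \<in> carrier A \<Longrightarrow>
    (x \<cdot>\<^bsub>A\<^esub> y) \<cdot>\<^bsub>A\<^esub> z = x \<cdot>\<^bsub>A\<^esub> (y \<cdot>\<^bsub>A\<^esub> z)"
  unfolding semigrp_def by blast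

lemma regular_semigrp_inverse:
  assumes "regular_semigrp A" "x \<in> carrier A"
  obtains y where "y \<in> carrier A" "x \<cdot>\<^bsub>A\<^esub> y \<cdot>\<^bsub>A\<^esub> x = x" "y \<cdot>\<^bsub>A\<^esub> x \<cdot>\<^bsub>A\<^esub> y = y"
proof -
  have A: "semigrp A" using assms(1) by (simp add: regular_semigrp_def)
  obtain z where z: "z \<in> carrier A" "x \<cdot>\<^bsub>A\<^esub> z \<cdot>\<^bsub>A\<^esub> x = x"
    using assms unfolding regular_semigrp_def by blast
  note S = A assms(2) z(1) semigrp_closed semigrp_assoc
  have xzx: "x \<cdot>\<^bsub>A\<^esub> (z \<cdot>\<^bsub>A\<^esub> x) = x" using z by (simp add: S)
  have xzxw: "x \<cdot>\<^bsub>A\<^esub> (z \<cdot>\<^bsub>A\<^esub> (x \<cdot>\<^bsub>A\<^esub> w)) = x \<cdot>\<^bsub>A\<^esub> w" if "w \<in> carrier A" for w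
    using arg_cong[OF xzx, of "\<lambda>u. u \<cdot>\<^bsub>A\<^esub> w"] that by (simp add: S)
  show thesis
    by (rule that[of "z \<cdot>\<^bsub>A\<^esub> x \<cdot>\<^bsub>A\<^esub> z"]) (simp_all add: S xzx xzxw)
qed

lemma adjoin_one_semigrp: "semigrp A \<Longrightarrow> semigrp (adjoin_one A)"
  by (auto simp: semigrp_def[of "adjoin_one A"] adjoin_one_def semigrp_closed semigrp_assoc)
     (auto simp: semigrp_def)

lemma adjoin_one_has_identity: "has_identity (adjoin_one A)"
proof (cases "has_identity A")
  case True
  then obtain e where "e \<in> carrier A" "\<forall>x\<in>carrier A. e \<cdot>\<^bsub>A\<^esub> x = x \<and> x \<cdot>\<^bsub>A\<^esub> e = x"
    unfolding has_identity_def by blast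
  with True show ?thesis
    unfolding has_identity_def[of "adjoin_one A"]
    by (intro bexI[of _ "Some e"]) (auto simp: adjoin_one_def)
next
  case False
  then show ?thesis
    unfolding has_identity_def[of "adjoin_one A"]
    by (intro bexI[of _ None]) (auto simp: adjoin_one_def split: option.splits)
qed

lemma Some_in_adjoin_one [simp]: "Some x \<in> carrier (adjoin_one A) \<longleftrightarrow> x \<in> carrier A"
  by (auto simp: adjoin_one_def)

lemma adjoin_one_mult_Some [simp]: "Some x \<cdot>\<^bsub>adjoin_one A\<^esub> Some y = Some (x \<cdot>\<^bsub>A\<^esub> y)"
  by (simp add: adjoin_one_def)

lemma left_ideal_iff:
  assumes "semigrp A" "x \<in> carrier A"
  shows "y \<in> left_ideal A x \<longleftrightarrow> y = x \<or> (\<exists>a\<in>carrier A. y = a \<cdot>\<^bsub>A\<^esub> x)"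
proof (cases "has_identity A")
  case True
  then have "\<exists>a\<in>carrier A. x = a \<cdot>\<^bsub>A\<^esub> x" using assms(2) unfolding has_identity_def by metis
  then show ?thesis using True by (auto simp: left_ideal_def adjoin_one_def)
next
  case False
  then show ?thesis by (auto simp: left_ideal_def adjoin_one_def)
qed

lemma right_ideal_iff:
  assumes "semigrp A" "x \<in> carrier A"
  shows "y \<in> right_ideal A x \<longleftrightarrow> y = x \<or> (\<exists>a\<in>carrier A. y = x \<cdot>\<^bsub>A\<^esub> a)"
proof (cases "has_identity A")
  case True
  then have "\<exists>a\<in>carrier A. x = x \<cdot>\<^bsub>A\<^esub> a" using assms(2) unfolding has_identity_def by metis
  then show ?thesis using True by (auto simp: right_ideal_def adjoin_one_def)
next
  case False
  then show ?thesis by (auto simp: right_ideal_def adjoin_one_def)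
qed

lemma left_ideal_self: "semigrp A \<Longrightarrow> x \<in> carrier A \<Longrightarrow> x \<in> left_ideal A x"
  by (simp add: left_ideal_iff)

lemma right_ideal_self: "semigrp A \<Longrightarrow> x \<in> carrier A \<Longrightarrow> x \<in> right_ideal A x"
  by (simp add: right_ideal_iff)

lemma left_ideal_mono:
  assumes "semigrp A" "x \<in> carrier A" "y \<in> left_ideal A x"
  shows "left_ideal A y \<subseteq> left_ideal A x"
proof -
  have y: "y \<in> carrier A" using assms by (auto simp: left_ideal_iff semigrp_closed)
  have "a \<cdot>\<^bsub>A\<^esub> y \<in> left_ideal A x" if a: "a \<in> carrier A" for a
  proof -
    consider "y = x" | b where "b \<in> carrier A" "y = b \<cdot>\<^bsub>A\<^esub> x"
      using assms by (auto simp: left_ideal_iff)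
    then have "\<exists>c\<in>carrier A. a \<cdot>\<^bsub>A\<^esub> y = c \<cdot>\<^bsub>A\<^esub> x"
      using a assms(1,2) by cases (auto simp flip: semigrp_assoc intro: semigrp_closed)
    then show ?thesis using assms by (simp add: left_ideal_iff)
  qed
  then show ?thesis using assms y by (auto simp: left_ideal_iff[OF assms(1) y])
qed

lemma right_ideal_mono:
  assumes "semigrp A" "x \<in> carrier A" "y \<in> right_ideal A x"
  shows "right_ideal A y \<subseteq> right_ideal A x"
proof -
  have y: "y \<in> carrier A" using assms by (auto simp: right_ideal_iff semigrp_closed)
  have "y \<cdot>\<^bsub>A\<^esub> a \<in> right_ideal A x" if a: "a \<in> carrier A" for a
  proof -
    consider "y = x" | b where "b \<in> carrier A" "y = x \<cdot>\<^bsub>A\<^esub> b"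
      using assms by (auto simp: right_ideal_iff)
    then have "\<exists>c\<in>carrier A. y \<cdot>\<^bsub>A\<^esub> a = x \<cdot>\<^bsub>A\<^esub> c"
      using a assms(1,2) by cases (auto simp: semigrp_assoc intro: semigrp_closed)
    then show ?thesis using assms by (simp add: right_ideal_iff)
  qed
  then show ?thesis using assms y by (auto simp: right_ideal_iff[OF assms(1) y])
qed

lemma two_sided_ideal_self:
  assumes "semigrp A" "x \<in> carrier A"
  shows "x \<in> two_sided_ideal A x"
proof -
  obtain e where e: "e \<in> carrier (adjoin_one A)"
    "\<forall>p\<in>carrier (adjoin_one A). e \<cdot>\<^bsub>adjoin_one A\<^esub> p = p \<and> p \<cdot>\<^bsub>adjoin_one A\<^esub> e = p"
    using adjoin_one_has_identity[of A] unfolding has_identity_def by blast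
  then show ?thesis
    unfolding two_sided_ideal_def
    by (intro CollectI bexI[of _ e]) (use assms in auto)
qed

text \<open>In the monoid \<open>A\<^sup>1\<close> the inclusion is the computation \<open>p' (p x q) q' = (p' p) x (q q')\<close>.\<close>

lemma two_sided_ideal_mono:
  assumes A: "semigrp A" and x: "x \<in> carrier A" and y: "y \<in> two_sided_ideal A x"
  shows "two_sided_ideal A y \<subseteq> two_sided_ideal A x"
proof
  let ?M = "adjoin_one A"
  note M = adjoin_one_semigrp[OF A]
  have x': "Some x \<in> carrier ?M" using x by simp
  fix z assume "z \<in> two_sided_ideal A y"
  then obtain p' q' where z: "p' \<in> carrier ?M" "q' \<in> carrier ?M"
    "Some z = p' \<cdot>\<^bsub>?M\<^esub> Some y \<cdot>\<^bsub>?M\<^esub> q'"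
    unfolding two_sided_ideal_def by blast
  from y obtain p q where pq: "p \<in> carrier ?M" "q \<in> carrier ?M"
    "Some y = p \<cdot>\<^bsub>?M\<^esub> Some x \<cdot>\<^bsub>?M\<^esub> q"
    unfolding two_sided_ideal_def by blast
  have "Some z = (p' \<cdot>\<^bsub>?M\<^esub> p) \<cdot>\<^bsub>?M\<^esub> Some x \<cdot>\<^bsub>?M\<^esub> (q \<cdot>\<^bsub>?M\<^esub> q')"
    using z pq x' M by (simp add: semigrp_assoc semigrp_closed del: adjoin_one_mult_Some)
  moreover have "p' \<cdot>\<^bsub>?M\<^esub> p \<in> carrier ?M" "q \<cdot>\<^bsub>?M\<^esub> q' \<in> carrier ?M"
    using z pq M by (simp_all add: semigrp_closed)
  ultimately show "z \<in> two_sided_ideal A x" unfolding two_sided_ideal_def by blast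
qed

text \<open>Splitting \<open>A\<^sup>1 x A\<^sup>1\<close> into a right and then a left multiplication produces an intermediate
  element in \<open>x A\<^sup>1\<close>; a right ideal containing \<open>x\<close> contains it.\<close>

lemma two_sided_ideal_eq_Union:
  assumes A: "semigrp A" and x: "x \<in> carrier A"
  shows "two_sided_ideal A x = (\<Union>z\<in>right_ideal A x. left_ideal A z)"
proof -
  let ?M = "adjoin_one A"
  note M = adjoin_one_semigrp[OF A]
  have assoc: "p \<cdot>\<^bsub>?M\<^esub> Some x \<cdot>\<^bsub>?M\<^esub> q = p \<cdot>\<^bsub>?M\<^esub> (Some x \<cdot>\<^bsub>?M\<^esub> q)"
    if "p \<in> carrier ?M" "q \<in> carrier ?M" for p q
    using M x that by (intro semigrp_assoc) auto
  have prod: "\<exists>z. Some x \<cdot>\<^bsub>?M\<^esub> q = Some z" for q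
    by (cases q) (auto simp: adjoin_one_def)
  show ?thesis
  proof
    show "two_sided_ideal A x \<subseteq> (\<Union>z\<in>right_ideal A x. left_ideal A z)"
    proof
      fix y assume "y \<in> two_sided_ideal A x"
      then obtain p q where pq: "p \<in> carrier ?M" "q \<in> carrier ?M"
        "Some y = p \<cdot>\<^bsub>?M\<^esub> (Some x \<cdot>\<^bsub>?M\<^esub> q)"
        unfolding two_sided_ideal_def using assoc by auto
      obtain z where "Some x \<cdot>\<^bsub>?M\<^esub> q = Some z" using prod by blast
      then have "z \<in> right_ideal A x" "y \<in> left_ideal A z"
        using pq unfolding right_ideal_def left_ideal_def by (metis (mono_tags, lifting) mem_Collect_eq)+
      then show "y \<in> (\<Union>z\<in>right_ideal A x. left_ideal A z)" by blast
    qed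
    show "(\<Union>z\<in>right_ideal A x. left_ideal A z) \<subseteq> two_sided_ideal A x"
    proof clarify
      fix y z assume "z \<in> right_ideal A x" "y \<in> left_ideal A z"
      then obtain p q where pq: "p \<in> carrier ?M" "q \<in> carrier ?M"
        "Some y = p \<cdot>\<^bsub>?M\<^esub> Some z" "Some z = Some x \<cdot>\<^bsub>?M\<^esub> q"
        unfolding right_ideal_def left_ideal_def by blast
      then have "Some y = p \<cdot>\<^bsub>?M\<^esub> Some x \<cdot>\<^bsub>?M\<^esub> q" using assoc by metis
      then show "y \<in> two_sided_ideal A x" unfolding two_sided_ideal_def using pq by blast
    qed
  qed
qed

lemma green_L_iff:
  assumes "semigrp A" "x \<in> carrier A" "y \<in> carrier A"
  shows "(x, y) \<in> green_L A \<longleftrightarrow> x \<in> left_ideal A y \<and> y \<in> left_ideal A x"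
  using left_ideal_self[OF assms(1,2)] left_ideal_self[OF assms(1,3)]
    left_ideal_mono[OF assms(1,2), of y] left_ideal_mono[OF assms(1,3), of x] assms(2,3)
  by (auto simp: green_L_def)

lemma green_R_iff:
  assumes "semigrp A" "x \<in> carrier A" "y \<in> carrier A"
  shows "(x, y) \<in> green_R A \<longleftrightarrow> x \<in> right_ideal A y \<and> y \<in> right_ideal A x"
  using right_ideal_self[OF assms(1,2)] right_ideal_self[OF assms(1,3)]
    right_ideal_mono[OF assms(1,2), of y] right_ideal_mono[OF assms(1,3), of x] assms(2,3)
  by (auto simp: green_R_def)

lemma green_J_iff:
  assumes "semigrp A" "x \<in> carrier A" "y \<in> carrier A"
  shows "(x, y) \<in> green_J A \<longleftrightarrow> x \<in> two_sided_ideal A y \<and> y \<in> two_sided_ideal A x"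
  using two_sided_ideal_self[OF assms(1,2)] two_sided_ideal_self[OF assms(1,3)]
    two_sided_ideal_mono[OF assms(1,2), of y] two_sided_ideal_mono[OF assms(1,3), of x] assms(2,3)
  by (auto simp: green_J_def)

section \<open>Regular right ideals\<close>

locale regular_right_ideal =
  fixes A B :: "'a smg"
  assumes semigrp_A: "semigrp A"
    and regular_B: "regular_semigrp B"
    and subset: "carrier B \<subseteq> carrier A"
    and mult_eq: "mult B = mult A"
    and right_ideal: "\<And>x a. x \<in> carrier B \<Longrightarrow> a \<in> carrier A \<Longrightarrow> x \<cdot>\<^bsub>A\<^esub> a \<in> carrier B"
begin

lemma semigrp_B: "semigrp B"
  using regular_B by (simp add: regular_semigrp_def)

lemma in_A: "x \<in> carrier B \<Longrightarrow> x \<in> carrier A"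
  using subset by blast

lemma inverse_in_B:
  assumes "x \<in> carrier B"
  obtains y where "y \<in> carrier B" "x \<cdot>\<^bsub>A\<^esub> y \<cdot>\<^bsub>A\<^esub> x = x"
  using regular_semigrp_inverse[OF regular_B assms] by (metis mult_eq)

lemma right_ideal_subset:
  assumes "x \<in> carrier B" "y \<in> right_ideal A x"
  shows "y \<in> carrier B"
  using assms right_ideal right_ideal_iff[OF semigrp_A in_A[OF assms(1)]] by auto

text \<open>If \<open>x = a y\<close> and \<open>y y' y = y\<close>, then \<open>x = (x y') y\<close>, and \<open>x y'\<close> lies in \<open>B\<close> although \<open>a\<close> may
  not.\<close>

lemma left_ideal_restrict:
  assumes x: "x \<in> carrier B" and y: "y \<in> carrier B"
  shows "x \<in> left_ideal A y \<longleftrightarrow> x \<in> left_ideal B y"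
proof
  assume "x \<in> left_ideal A y"
  then consider "x = y" | a where "a \<in> carrier A" "x = a \<cdot>\<^bsub>A\<^esub> y"
    using left_ideal_iff[OF semigrp_A in_A[OF y]] by blast
  then show "x \<in> left_ideal B y"
  proof cases
    case 1
    then show ?thesis using y by (simp add: left_ideal_self semigrp_B)
  next
    case 2
    obtain y' where y': "y' \<in> carrier B" "y \<cdot>\<^bsub>A\<^esub> y' \<cdot>\<^bsub>A\<^esub> y = y" using inverse_in_B[OF y] .
    have "a \<cdot>\<^bsub>A\<^esub> y \<cdot>\<^bsub>A\<^esub> y' \<cdot>\<^bsub>A\<^esub> y = a \<cdot>\<^bsub>A\<^esub> (y \<cdot>\<^bsub>A\<^esub> y' \<cdot>\<^bsub>A\<^esub> y)"
      using 2 y y' in_A by (simp add: semigrp_A semigrp_assoc semigrp_closed)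
    then have "x = x \<cdot>\<^bsub>A\<^esub> y' \<cdot>\<^bsub>A\<^esub> y" using 2 y' by simp
    moreover have "x \<cdot>\<^bsub>A\<^esub> y' \<in> carrier B" using right_ideal x y' in_A by blast
    ultimately show ?thesis
      using left_ideal_iff[OF semigrp_B y] mult_eq by auto
  qed
next
  assume "x \<in> left_ideal B y"
  then show "x \<in> left_ideal A y"
    using left_ideal_iff[OF semigrp_B y] left_ideal_iff[OF semigrp_A in_A[OF y]] mult_eq in_A
    by auto
qed

lemma right_ideal_restrict:
  assumes x: "x \<in> carrier B" and y: "y \<in> carrier B"
  shows "x \<in> right_ideal A y \<longleftrightarrow> x \<in> right_ideal B y"
proof
  assume "x \<in> right_ideal A y"
  then consider "x = y" | a where "a \<in> carrier A" "x = y \<cdot>\<^bsub>A\<^esub> a"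
    using right_ideal_iff[OF semigrp_A in_A[OF y]] by blast
  then show "x \<in> right_ideal B y"
  proof cases
    case 1
    then show ?thesis using y by (simp add: right_ideal_self semigrp_B)
  next
    case 2
    obtain y' where y': "y' \<in> carrier B" "y \<cdot>\<^bsub>A\<^esub> y' \<cdot>\<^bsub>A\<^esub> y = y" using inverse_in_B[OF y] .
    have "y \<cdot>\<^bsub>A\<^esub> (y' \<cdot>\<^bsub>A\<^esub> (y \<cdot>\<^bsub>A\<^esub> a)) = (y \<cdot>\<^bsub>A\<^esub> y' \<cdot>\<^bsub>A\<^esub> y) \<cdot>\<^bsub>A\<^esub> a"
      using 2(1) y y'(1) by (simp add: in_A semigrp_A semigrp_assoc semigrp_closed)
    then have "x = y \<cdot>\<^bsub>A\<^esub> (y' \<cdot>\<^bsub>A\<^esub> x)" using 2 y' by simp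
    moreover have "y' \<cdot>\<^bsub>A\<^esub> x \<in> carrier B" using right_ideal x y' in_A by blast
    ultimately show ?thesis
      using right_ideal_iff[OF semigrp_B y] mult_eq by auto
  qed
next
  assume "x \<in> right_ideal B y"
  then show "x \<in> right_ideal A y"
    using right_ideal_iff[OF semigrp_B y] right_ideal_iff[OF semigrp_A in_A[OF y]] mult_eq in_A
    by auto
qed

lemma two_sided_ideal_restrict:
  assumes x: "x \<in> carrier B" and y: "y \<in> carrier B"
  shows "x \<in> two_sided_ideal A y \<longleftrightarrow> x \<in> two_sided_ideal B y"
proof -
  have B: "z \<in> carrier B" if "z \<in> right_ideal B y" for z
    using that y by (auto simp: right_ideal_iff semigrp_B semigrp_closed)
  have "(\<exists>z\<in>right_ideal A y. x \<in> left_ideal A z) \<longleftrightarrow> (\<exists>z\<in>right_ideal B y. x \<in> left_ideal B z)"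
    using B right_ideal_subset[OF y] left_ideal_restrict[OF x] right_ideal_restrict[OF _ y]
    by blast
  then show ?thesis
    by (simp add: two_sided_ideal_eq_Union semigrp_A semigrp_B in_A y)
qed

lemma restrict_relI:
  assumes "P \<subseteq> C \<times> C" "\<And>x y. x \<in> C \<Longrightarrow> y \<in> C \<Longrightarrow> (x, y) \<in> Q \<longleftrightarrow> (x, y) \<in> P"
  shows "Q \<inter> (C \<times> C) = P"
  using assms by auto

lemma green_L_restrict: "green_L A \<inter> (carrier B \<times> carrier B) = green_L B"
proof (rule restrict_relI)
  show "green_L B \<subseteq> carrier B \<times> carrier B" by (auto simp: green_L_def)
qed (simp add: green_L_iff semigrp_A semigrp_B in_A left_ideal_restrict)

lemma green_R_restrict: "green_R A \<inter> (carrier B \<times> carrier B) = green_R B"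
proof (rule restrict_relI)
  show "green_R B \<subseteq> carrier B \<times> carrier B" by (auto simp: green_R_def)
qed (simp add: green_R_iff semigrp_A semigrp_B in_A right_ideal_restrict)

lemma green_J_restrict: "green_J A \<inter> (carrier B \<times> carrier B) = green_J B"
proof (rule restrict_relI)
  show "green_J B \<subseteq> carrier B \<times> carrier B" by (auto simp: green_J_def)
qed (simp add: green_J_iff semigrp_A semigrp_B in_A two_sided_ideal_restrict)

lemma green_H_restrict: "green_H A \<inter> (carrier B \<times> carrier B) = green_H B"
  using green_L_restrict green_R_restrict unfolding green_H_def by blast

text \<open>If \<open>x \<L> z \<R> y\<close> in \<open>A\<close> with \<open>x, y\<close> in \<open>B\<close>, then \<open>z \<in> y A\<^sup>1 \<subseteq> B\<close>.\<close>

lemma green_D_restrict: "green_D A \<inter> (carrier B \<times> carrier B) = green_D B"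
proof
  show "green_D A \<inter> (carrier B \<times> carrier B) \<subseteq> green_D B"
  proof clarify
    fix x y assume xy: "(x, y) \<in> green_D A" "x \<in> carrier B" "y \<in> carrier B"
    then obtain z where z: "(x, z) \<in> green_L A" "(z, y) \<in> green_R A"
      unfolding green_D_def by blast
    then have "z \<in> carrier A" by (simp add: green_L_def)
    then have "z \<in> right_ideal A y" 
      using z xy by (simp add: green_R_iff semigrp_A in_A)
    then have "z \<in> carrier B" using right_ideal_subset xy by blast
    then show "(x, y) \<in> green_D B"
      using z xy green_L_restrict green_R_restrict unfolding green_D_def by blast
  qed
  show "green_D B \<subseteq> green_D A \<inter> (carrier B \<times> carrier B)"
    unfolding green_D_def green_L_restrict[symmetric] green_R_restrict[symmetric] by blast
qed

text \<open>The witnesses \<open>a, b\<close> are replaced by \<open>s t'\<close> and \<open>t' s\<close>, where \<open>t'\<close> is an inverse of \<open>t\<close> in \<open>B\<close>.\<close>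

lemma natural_order_restrict: "natural_order A \<inter> (carrier B \<times> carrier B) = natural_order B"
proof
  show "natural_order A \<inter> (carrier B \<times> carrier B) \<subseteq> natural_order B"
  proof clarify
    fix s t assume "(s, t) \<in> natural_order A" and s: "s \<in> carrier B" and t: "t \<in> carrier B"
    then obtain a b where ab: "a \<in> carrier A" "b \<in> carrier A"
      and eq: "s = a \<cdot>\<^bsub>A\<^esub> t" "s = t \<cdot>\<^bsub>A\<^esub> b" "s = s \<cdot>\<^bsub>A\<^esub> b"
      unfolding natural_order_def by blast
    obtain t' where t': "t' \<in> carrier B" "t \<cdot>\<^bsub>A\<^esub> t' \<cdot>\<^bsub>A\<^esub> t = t" using inverse_in_B[OF t] .
    note C = ab s t t'(1) in_A semigrp_A semigrp_assoc semigrp_closed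
    have "a \<cdot>\<^bsub>A\<^esub> t \<cdot>\<^bsub>A\<^esub> t' \<cdot>\<^bsub>A\<^esub> t = a \<cdot>\<^bsub>A\<^esub> (t \<cdot>\<^bsub>A\<^esub> t' \<cdot>\<^bsub>A\<^esub> t)" by (simp add: C)
    then have 1: "s = (s \<cdot>\<^bsub>A\<^esub> t') \<cdot>\<^bsub>A\<^esub> t" using eq(1) t' by simp
    have "t \<cdot>\<^bsub>A\<^esub> (t' \<cdot>\<^bsub>A\<^esub> (t \<cdot>\<^bsub>A\<^esub> b)) = (t \<cdot>\<^bsub>A\<^esub> t' \<cdot>\<^bsub>A\<^esub> t) \<cdot>\<^bsub>A\<^esub> b" by (simp add: C)
    then have 2: "s = t \<cdot>\<^bsub>A\<^esub> (t' \<cdot>\<^bsub>A\<^esub> s)" using eq(2) t' by simp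
    have "s \<cdot>\<^bsub>A\<^esub> (t' \<cdot>\<^bsub>A\<^esub> (t \<cdot>\<^bsub>A\<^esub> b)) = (s \<cdot>\<^bsub>A\<^esub> t') \<cdot>\<^bsub>A\<^esub> t \<cdot>\<^bsub>A\<^esub> b" by (simp add: C)
    then have 3: "s = s \<cdot>\<^bsub>A\<^esub> (t' \<cdot>\<^bsub>A\<^esub> s)" using eq(2,3) 1 by simp
    have "s \<cdot>\<^bsub>A\<^esub> t' \<in> carrier B" "t' \<cdot>\<^bsub>A\<^esub> s \<in> carrier B" using right_ideal s t' in_A by blast+
    then show "(s, t) \<in> natural_order B"
      unfolding natural_order_def mult_eq using s t 1 2 3 by blast
  qed
  show "natural_order B \<subseteq> natural_order A \<inter> (carrier B \<times> carrier B)"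
    unfolding natural_order_def mult_eq using in_A by blast
qed

end

section \<open>The semigroup of triples with \<L>-related components\<close>

text \<open>Both product rules multiply on the right by a single element \<open>w\<close>, so a right congruence on
  \<open>S\<close> that relates the first two components is preserved.\<close>

lemma TR2_mult_shape:
  obtains w where "w \<in> {u, v}" "\<And>s t. TR2_mult S (s, t, \<alpha>) (u, v, \<beta>) = (s \<cdot>\<^bsub>S\<^esub> w, t \<cdot>\<^bsub>S\<^esub> w, \<beta>)"
  by (cases \<alpha>) auto

lemma TR2_semigrp:
  assumes S: "semigrp S"
  shows "semigrp (TR2 S)"
proof -
  have "TR2_mult S x y \<in> carrier S \<times> carrier S \<times> UNIV"
    if "x \<in> carrier S \<times> carrier S \<times> UNIV" "y \<in> carrier S \<times> carrier S \<times> UNIV" for x y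
  proof -
    obtain a b \<alpha> c d \<beta> where "x = (a, b, \<alpha>)" "y = (c, d, \<beta>)" by (metis prod_cases3)
    then show ?thesis using that S by (cases \<alpha>) (auto simp: semigrp_closed)
  qed
  moreover have "TR2_mult S (TR2_mult S x y) z = TR2_mult S x (TR2_mult S y z)"
    if "x \<in> carrier S \<times> carrier S \<times> UNIV" "y \<in> carrier S \<times> carrier S \<times> UNIV"
      "z \<in> carrier S \<times> carrier S \<times> UNIV" for x y z
  proof -
    obtain a b \<alpha> c d \<beta> e f \<gamma> where "x = (a, b, \<alpha>)" "y = (c, d, \<beta>)" "z = (e, f, \<gamma>)"
      by (metis prod_cases3)
    then show ?thesis
      using that S by (cases \<alpha>; cases \<beta>) (auto simp: semigrp_assoc)
  qed
  ultimately show ?thesis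
    using S by (auto simp: semigrp_def[of "TR2 S"] TR2_def) (auto simp: semigrp_def)
qed

lemma generated_subset:
  assumes "semigrp A" "X \<subseteq> carrier A"
  shows "generated A X \<subseteq> carrier A"
proof
  fix x assume "x \<in> generated A X"
  then show "x \<in> carrier A"
    by induction (use assms in \<open>auto simp: semigrp_closed\<close>)
qed

lemma T_smg_subset: "semigrp S \<Longrightarrow> carrier (T_smg S) \<subseteq> carrier (TR2 S)"
  using generated_subset[OF TR2_semigrp, of S "T_gens S"]
  by (auto simp: T_smg_def T_gens_def idems_def)

lemma green_L_mult_right:
  assumes S: "semigrp S" and st: "(s, t) \<in> green_L S" and w: "w \<in> carrier S"
  shows "(s \<cdot>\<^bsub>S\<^esub> w, t \<cdot>\<^bsub>S\<^esub> w) \<in> green_L S"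
proof -
  have c: "s \<in> carrier S" "t \<in> carrier S" using st by (auto simp: green_L_def)
  have "x \<cdot>\<^bsub>S\<^esub> w \<in> left_ideal S (y \<cdot>\<^bsub>S\<^esub> w)"
    if "x \<in> left_ideal S y" "x \<in> carrier S" "y \<in> carrier S" for x y
    using that S w by (auto simp: left_ideal_iff semigrp_closed) (metis semigrp_assoc)
  then show ?thesis using st c S w by (simp add: green_L_iff semigrp_closed)
qed

lemma green_L_sym: "(s, t) \<in> green_L S \<Longrightarrow> (t, s) \<in> green_L S"
  by (auto simp: green_L_def)

lemma green_L_carrier: "(s, t) \<in> green_L S \<Longrightarrow> s \<in> carrier S \<and> t \<in> carrier S"
  by (auto simp: green_L_def)

lemma green_L_refl: "s \<in> carrier S \<Longrightarrow> (s, s) \<in> green_L S"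
  by (auto simp: green_L_def)

text \<open>For \<open>s \<L> t\<close> the idempotent \<open>t' t\<close> is a right identity of \<open>S\<^sup>1 t\<close>, hence of \<open>s\<close>.\<close>

lemma green_L_absorb:
  assumes S: "semigrp S" and st: "(s, t) \<in> green_L S"
    and t': "t' \<in> carrier S" "t \<cdot>\<^bsub>S\<^esub> t' \<cdot>\<^bsub>S\<^esub> t = t"
  shows "s \<cdot>\<^bsub>S\<^esub> t' \<cdot>\<^bsub>S\<^esub> t = s"
proof -
  have c: "s \<in> carrier S" "t \<in> carrier S" using green_L_carrier[OF st] by auto
  have "s = t \<or> (\<exists>a\<in>carrier S. s = a \<cdot>\<^bsub>S\<^esub> t)"
    using st S c by (simp add: green_L_iff left_ideal_iff)
  then show ?thesis
  proof
    assume "\<exists>a\<in>carrier S. s = a \<cdot>\<^bsub>S\<^esub> t"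
    then obtain a where a: "a \<in> carrier S" "s = a \<cdot>\<^bsub>S\<^esub> t" by blast
    have "a \<cdot>\<^bsub>S\<^esub> t \<cdot>\<^bsub>S\<^esub> t' \<cdot>\<^bsub>S\<^esub> t = a \<cdot>\<^bsub>S\<^esub> (t \<cdot>\<^bsub>S\<^esub> t' \<cdot>\<^bsub>S\<^esub> t)"
      using a c t' S by (simp add: semigrp_assoc semigrp_closed)
    then show ?thesis using a t' by simp
  qed (use t' in simp)
qed

lemma idempotent_in_T_gens:
  assumes "semigrp S" "(s, t) \<in> green_L S"
    and "TR2_mult S (s, t, \<alpha>) (s, t, \<alpha>) = (s, t, \<alpha>)"
  shows "(s, t, \<alpha>) \<in> T_gens S"
  using assms green_L_carrier[OF assms(2)]
  by (auto simp: T_gens_def idems_def TR2_def green_L_iff)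

text \<open>If \<open>(c, d, \<sigma>)\<close> is idempotent then so is \<open>d\<close>, and a left factor tagged \<open>\<sigma>\<close> would multiply by
  this \<open>d\<close>; in general \<open>s\<close> and \<open>t\<close> cannot be reached that way. A left factor tagged \<open>\<tau>\<close> multiplies
  by \<open>c\<close>, which can be \<open>s\<close> when \<open>d = s' s\<close>. So the left factor carries the opposite tag, and the
  case of \<open>\<tau>\<close> is symmetric.\<close>

lemma product_of_two_idempotents:
  assumes reg: "regular_semigrp S" and st: "(s, t) \<in> green_L S"
  obtains a b \<beta> c d where
    "(a, b) \<in> green_L S" "TR2_mult S (a, b, \<beta>) (a, b, \<beta>) = (a, b, \<beta>)"
    "(c, d) \<in> green_L S" "TR2_mult S (c, d, \<alpha>) (c, d, \<alpha>) = (c, d, \<alpha>)"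
    "TR2_mult S (a, b, \<beta>) (c, d, \<alpha>) = (s, t, \<alpha>)"
proof -
  have S: "semigrp S" using reg by (simp add: regular_semigrp_def)
  have c: "s \<in> carrier S" "t \<in> carrier S" using green_L_carrier[OF st] by auto
  obtain s' where s': "s' \<in> carrier S" "s \<cdot>\<^bsub>S\<^esub> s' \<cdot>\<^bsub>S\<^esub> s = s" "s' \<cdot>\<^bsub>S\<^esub> s \<cdot>\<^bsub>S\<^esub> s' = s'"
    using regular_semigrp_inverse[OF reg c(1)] .
  obtain t' where t': "t' \<in> carrier S" "t \<cdot>\<^bsub>S\<^esub> t' \<cdot>\<^bsub>S\<^esub> t = t" "t' \<cdot>\<^bsub>S\<^esub> t \<cdot>\<^bsub>S\<^esub> t' = t'"
    using regular_semigrp_inverse[OF reg c(2)] .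
  have inverse_L: "(x, x' \<cdot>\<^bsub>S\<^esub> x) \<in> green_L S"
    if "x \<in> carrier S" "x' \<in> carrier S" "x \<cdot>\<^bsub>S\<^esub> x' \<cdot>\<^bsub>S\<^esub> x = x" for x x'
    using that S by (auto simp: green_L_iff left_ideal_iff semigrp_closed semigrp_assoc) metis
  have ts: "t \<cdot>\<^bsub>S\<^esub> s' \<cdot>\<^bsub>S\<^esub> s = t" by (rule green_L_absorb[OF S green_L_sym[OF st] s'(1,2)])
  have st': "s \<cdot>\<^bsub>S\<^esub> t' \<cdot>\<^bsub>S\<^esub> t = s" by (rule green_L_absorb[OF S st t'(1,2)])
  note C = c s'(1) t'(1) S semigrp_closed semigrp_assoc
  note E = s'(2,3) t'(2,3) ts st'
  have assoc: "s \<cdot>\<^bsub>S\<^esub> (s' \<cdot>\<^bsub>S\<^esub> s) = s" "s' \<cdot>\<^bsub>S\<^esub> (s \<cdot>\<^bsub>S\<^esub> s') = s'"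
    "t \<cdot>\<^bsub>S\<^esub> (t' \<cdot>\<^bsub>S\<^esub> t) = t" "t' \<cdot>\<^bsub>S\<^esub> (t \<cdot>\<^bsub>S\<^esub> t') = t'"
    "t \<cdot>\<^bsub>S\<^esub> (s' \<cdot>\<^bsub>S\<^esub> s) = t" "s \<cdot>\<^bsub>S\<^esub> (t' \<cdot>\<^bsub>S\<^esub> t) = s"
    using E by (simp_all add: C)
  show thesis
  proof (cases \<alpha>)
    case sigma
    show thesis
    proof (rule that[of "s \<cdot>\<^bsub>S\<^esub> s'" "t \<cdot>\<^bsub>S\<^esub> s'" tau s "s' \<cdot>\<^bsub>S\<^esub> s"])
      show "(s \<cdot>\<^bsub>S\<^esub> s', t \<cdot>\<^bsub>S\<^esub> s') \<in> green_L S" by (rule green_L_mult_right[OF S st s'(1)])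
      show "(s, s' \<cdot>\<^bsub>S\<^esub> s) \<in> green_L S" by (rule inverse_L[OF c(1) s'(1,2)])
    qed (simp_all add: C assoc sigma)
  next
    case tau
    show thesis
    proof (rule that[of "s \<cdot>\<^bsub>S\<^esub> t'" "t \<cdot>\<^bsub>S\<^esub> t'" sigma "t' \<cdot>\<^bsub>S\<^esub> t" t])
      show "(s \<cdot>\<^bsub>S\<^esub> t', t \<cdot>\<^bsub>S\<^esub> t') \<in> green_L S" by (rule green_L_mult_right[OF S st t'(1)])
      show "(t' \<cdot>\<^bsub>S\<^esub> t, t) \<in> green_L S" by (rule green_L_sym[OF inverse_L[OF c(2) t'(1,2)]])
    qed (simp_all add: C assoc tau)
  qed
qed

text \<open>A triple with \<open>s \<L> t\<close> lies in \<open>T(S)\<close> because its two idempotent factors are generators of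
  \<open>T(S)\<close>.\<close>

lemma R_smg_carrier:
  assumes "regular_semigrp S"
  shows "carrier (R_smg S) = {(s, t, \<alpha>). (s, t) \<in> green_L S}"
proof -
  have S: "semigrp S" using assms by (simp add: regular_semigrp_def)
  have "(s, t, \<alpha>) \<in> carrier (T_smg S)" if st: "(s, t) \<in> green_L S" for s t \<alpha>
  proof -
    obtain a b \<beta> c d where e:
      "(a, b) \<in> green_L S" "TR2_mult S (a, b, \<beta>) (a, b, \<beta>) = (a, b, \<beta>)"
      "(c, d) \<in> green_L S" "TR2_mult S (c, d, \<alpha>) (c, d, \<alpha>) = (c, d, \<alpha>)"
      "TR2_mult S (a, b, \<beta>) (c, d, \<alpha>) = (s, t, \<alpha>)"
      using product_of_two_idempotents[OF assms st] .
    have "(a, b, \<beta>) \<cdot>\<^bsub>TR2 S\<^esub> (c, d, \<alpha>) \<in> generated (TR2 S) (T_gens S)"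
      using e S by (intro generated.prod generated.incl idempotent_in_T_gens)
    then show ?thesis using e by (simp add: T_smg_def TR2_def)
  qed
  then show ?thesis by (auto simp: R_smg_def)
qed

lemma T_smg_semigrp:
  assumes "regular_semigrp S"
  shows "semigrp (T_smg S)"
proof -
  have S: "semigrp S" using assms by (simp add: regular_semigrp_def)
  obtain x where "x \<in> carrier S" using S by (auto simp: semigrp_def)
  then have "(x, x, sigma) \<in> carrier (R_smg S)"
    using R_smg_carrier[OF assms] green_L_refl by simp
  then have ne: "carrier (T_smg S) \<noteq> {}" by (auto simp: R_smg_def)
  have cl: "TR2_mult S x y \<in> carrier (T_smg S)"
    if "x \<in> carrier (T_smg S)" "y \<in> carrier (T_smg S)" for x y
    using that generated.prod[of x "TR2 S" "T_gens S" y] by (simp add: T_smg_def TR2_def)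
  have assoc: "TR2_mult S (TR2_mult S x y) z = TR2_mult S x (TR2_mult S y z)"
    if "x \<in> carrier (T_smg S)" "y \<in> carrier (T_smg S)" "z \<in> carrier (T_smg S)" for x y z
    using semigrp_assoc[OF TR2_semigrp[OF S], of x y z] that T_smg_subset[OF S]
    by (auto simp: TR2_def)
  have mult: "mult (T_smg S) = TR2_mult S" by (simp add: T_smg_def)
  show ?thesis
    unfolding semigrp_def mult using ne cl assoc by blast
qed

lemma R_smg_right_ideal:
  assumes reg: "regular_semigrp S"
    and x: "x \<in> carrier (R_smg S)" and y: "y \<in> carrier (T_smg S)"
  shows "TR2_mult S x y \<in> carrier (R_smg S)"
proof -
  have S: "semigrp S" using reg by (simp add: regular_semigrp_def)
  obtain s t \<alpha> where x': "x = (s, t, \<alpha>)" "(s, t) \<in> green_L S"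
    using x R_smg_carrier[OF reg] by auto
  obtain u v \<beta> where y': "y = (u, v, \<beta>)" "u \<in> carrier S" "v \<in> carrier S"
    using y T_smg_subset[OF S] by (auto simp: TR2_def)
  obtain w where "w \<in> {u, v}" "TR2_mult S (s, t, \<alpha>) (u, v, \<beta>) = (s \<cdot>\<^bsub>S\<^esub> w, t \<cdot>\<^bsub>S\<^esub> w, \<beta>)"
    using TR2_mult_shape[of u v S \<alpha> \<beta>] by metis
  then show ?thesis
    using x' y' green_L_mult_right[OF S x'(2), of w] by (auto simp: R_smg_carrier[OF reg])
qed

lemma R_smg_regular:
  assumes reg: "regular_semigrp S"
  shows "regular_semigrp (R_smg S)"
proof -
  have S: "semigrp S" using reg by (simp add: regular_semigrp_def)
  have mult: "mult (R_smg S) = TR2_mult S" "mult (T_smg S) = TR2_mult S"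
    by (simp_all add: R_smg_def T_smg_def)
  have sub: "x \<in> carrier (T_smg S)" if "x \<in> carrier (R_smg S)" for x
    using that by (auto simp: R_smg_def)
  obtain x where "x \<in> carrier S" using S by (auto simp: semigrp_def)
  then have "(x, x, sigma) \<in> carrier (R_smg S)"
    using green_L_refl by (simp add: R_smg_carrier[OF reg])
  then have ne: "carrier (R_smg S) \<noteq> {}" by blast
  have "TR2_mult S (TR2_mult S x y) z = TR2_mult S x (TR2_mult S y z)"
    if "x \<in> carrier (R_smg S)" "y \<in> carrier (R_smg S)" "z \<in> carrier (R_smg S)" for x y z
    using semigrp_assoc[OF T_smg_semigrp[OF reg], of x y z] that sub mult by simp
  then have sg: "semigrp (R_smg S)"
    unfolding semigrp_def mult using ne R_smg_right_ideal[OF reg] sub by blast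
  have "\<exists>y\<in>carrier (R_smg S). TR2_mult S (TR2_mult S x y) x = x" if "x \<in> carrier (R_smg S)" for x
  proof -
    obtain s t \<alpha> where x: "x = (s, t, \<alpha>)" "(s, t) \<in> green_L S"
      using \<open>x \<in> carrier (R_smg S)\<close> R_smg_carrier[OF reg] by auto
    \<comment> \<open>\<open>r\<close> is the component of \<open>x\<close> by which an element tagged \<open>\<alpha>\<close> multiplies.\<close>
    define r where "r = (if \<alpha> = sigma then t else s)"
    have r: "r \<in> carrier S" "(s, r) \<in> green_L S" "(t, r) \<in> green_L S"
      using x green_L_carrier[OF x(2)] green_L_refl green_L_sym by (auto simp: r_def)
    obtain r' where r': "r' \<in> carrier S" "r \<cdot>\<^bsub>S\<^esub> r' \<cdot>\<^bsub>S\<^esub> r = r"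
      using regular_semigrp_inverse[OF reg r(1)] .
    have "s \<cdot>\<^bsub>S\<^esub> r' \<cdot>\<^bsub>S\<^esub> r = s" "t \<cdot>\<^bsub>S\<^esub> r' \<cdot>\<^bsub>S\<^esub> r = t"
      using green_L_absorb[OF S _ r'] r by blast+
    then have "TR2_mult S (TR2_mult S x (r', r', \<alpha>)) x = x"
      by (cases \<alpha>) (simp_all add: x r_def)
    moreover have "(r', r', \<alpha>) \<in> carrier (R_smg S)"
      using r' green_L_refl by (simp add: R_smg_carrier[OF reg])
    ultimately show ?thesis by blast
  qed
  then show ?thesis unfolding regular_semigrp_def mult using sg by blast
qed

lemma R_smg_regular_right_ideal:
  assumes reg: "regular_semigrp S"
  shows "regular_right_ideal (T_smg S) (R_smg S)"
proof
  show "carrier (R_smg S) \<subseteq> carrier (T_smg S)" by (auto simp: R_smg_def)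
  show "mult (R_smg S) = mult (T_smg S)" by (simp add: R_smg_def T_smg_def)
  show "x \<cdot>\<^bsub>T_smg S\<^esub> a \<in> carrier (R_smg S)"
    if "x \<in> carrier (R_smg S)" "a \<in> carrier (T_smg S)" for x a
    using R_smg_right_ideal[OF reg that] by (simp add: T_smg_def)
qed (use T_smg_semigrp[OF reg] R_smg_regular[OF reg] in simp_all)

section \<open>Depth\<close>

lemma idem_prods_2: "idem_prods A 2 = {x \<cdot>\<^bsub>A\<^esub> y | x y. x \<in> idems A \<and> y \<in> idems A}"
  by (simp add: numeral_2_eq_2)

lemma R_smg_idem_prods_2:
  assumes reg: "regular_semigrp S"
  shows "idem_prods (R_smg S) 2 = carrier (R_smg S)"
proof
  have R: "semigrp (R_smg S)" using R_smg_regular[OF reg] by (simp add: regular_semigrp_def)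
  show "idem_prods (R_smg S) 2 \<subseteq> carrier (R_smg S)"
    using semigrp_closed[OF R] by (auto simp: idem_prods_2 idems_def)
  show "carrier (R_smg S) \<subseteq> idem_prods (R_smg S) 2"
  proof
    fix x assume "x \<in> carrier (R_smg S)"
    then obtain s t \<alpha> where x: "x = (s, t, \<alpha>)" "(s, t) \<in> green_L S"
      using R_smg_carrier[OF reg] by auto
    obtain a b \<beta> c d where e:
      "(a, b) \<in> green_L S" "TR2_mult S (a, b, \<beta>) (a, b, \<beta>) = (a, b, \<beta>)"
      "(c, d) \<in> green_L S" "TR2_mult S (c, d, \<alpha>) (c, d, \<alpha>) = (c, d, \<alpha>)"
      "TR2_mult S (a, b, \<beta>) (c, d, \<alpha>) = (s, t, \<alpha>)"
      using product_of_two_idempotents[OF reg x(2)] .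
    have mult: "mult (R_smg S) = TR2_mult S" by (simp add: R_smg_def)
    have "(a, b, \<beta>) \<in> idems (R_smg S)" "(c, d, \<alpha>) \<in> idems (R_smg S)"
      using e by (simp_all add: idems_def R_smg_carrier[OF reg] mult)
    moreover have "x = (a, b, \<beta>) \<cdot>\<^bsub>R_smg S\<^esub> (c, d, \<alpha>)" using e x mult by simp
    ultimately show "x \<in> idem_prods (R_smg S) 2" unfolding idem_prods_2 by blast
  qed
qed

text \<open>A last factor that is idempotent can be repeated.\<close>

lemma idem_prods_2_subset_3:
  assumes "semigrp A"
  shows "idem_prods A 2 \<subseteq> idem_prods A 3"
proof
  fix x assume "x \<in> idem_prods A 2"
  then obtain e f where ef: "x = e \<cdot>\<^bsub>A\<^esub> f" "e \<in> idems A" "f \<in> idems A"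
    by (auto simp: idem_prods_2)
  have "x = e \<cdot>\<^bsub>A\<^esub> f \<cdot>\<^bsub>A\<^esub> f"
    using ef assms by (auto simp: idems_def semigrp_assoc)
  then show "x \<in> idem_prods A 3" using ef by (auto simp: numeral_3_eq_3)
qed

lemma R_smg_semiband:
  assumes reg: "regular_semigrp S"
  shows "semiband (R_smg S)"
proof -
  have R: "semigrp (R_smg S)" using R_smg_regular[OF reg] by (simp add: regular_semigrp_def)
  have "idem_prods (R_smg S) 2 \<subseteq> generated (R_smg S) (idems (R_smg S))"
    unfolding idem_prods_2 by (blast intro: generated.intros)
  moreover have "generated (R_smg S) (idems (R_smg S)) \<subseteq> carrier (R_smg S)"
    using R by (intro generated_subset) (auto simp: idems_def)
  ultimately show ?thesis
    using R R_smg_idem_prods_2[OF reg] by (auto simp: semiband_def)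
qed

lemma R_smg_idems_eq_carrier_iff:
  assumes reg: "regular_semigrp S"
  shows "idems (R_smg S) = carrier (R_smg S) \<longleftrightarrow> band S"
proof
  have S: "semigrp S" using reg by (simp add: regular_semigrp_def)
  have mult: "mult (R_smg S) = TR2_mult S" by (simp add: R_smg_def)
  {
    assume I: "idems (R_smg S) = carrier (R_smg S)"
    have "s \<cdot>\<^bsub>S\<^esub> s = s" if "s \<in> carrier S" for s
    proof -
      have "(s, s, sigma) \<in> carrier (R_smg S)"
        using that green_L_refl by (simp add: R_smg_carrier[OF reg])
      then have "(s, s, sigma) \<in> idems (R_smg S)" using I by simp
      then show ?thesis by (simp add: idems_def mult)
    qed
    then show "band S" using S by (auto simp: band_def idems_def)
  next
    assume b: "band S"
    have "TR2_mult S (s, t, \<alpha>) (s, t, \<alpha>) = (s, t, \<alpha>)" if st: "(s, t) \<in> green_L S" for s t \<alpha>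
    proof -
      have "s \<cdot>\<^bsub>S\<^esub> s = s" "t \<cdot>\<^bsub>S\<^esub> t = t"
        using b green_L_carrier[OF st] by (auto simp: band_def idems_def)
      then show ?thesis
        using green_L_band_right[OF b st] green_L_band_right[OF b green_L_sym[OF st]]
        by (cases \<alpha>) simp_all
    qed
    then show "idems (R_smg S) = carrier (R_smg S)"
      by (auto simp: idems_def R_smg_carrier[OF reg] mult)
  }
qed

lemma R_smg_depth:
  assumes reg: "regular_semigrp S"
  shows "has_depth (R_smg S) (if band S then 1 else 2)"
proof -
  let ?R = "R_smg S"
  have R: "semigrp ?R" using R_smg_regular[OF reg] by (simp add: regular_semigrp_def)
  note two = R_smg_idem_prods_2[OF reg]
  have "idem_prods ?R 3 \<subseteq> carrier ?R"
  proof -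
    have "idem_prods ?R 3 = {x \<cdot>\<^bsub>?R\<^esub> y | x y. x \<in> idem_prods ?R 2 \<and> y \<in> idems ?R}"
      by (simp add: numeral_3_eq_3 numeral_2_eq_2)
    then show ?thesis using two semigrp_closed[OF R] by (auto simp: idems_def)
  qed
  then have three: "idem_prods ?R 3 = carrier ?R"
    using idem_prods_2_subset_3[OF R] two by blast
  have one: "idem_prods ?R 1 = idems ?R" by simp
  show ?thesis
  proof (cases "band S")
    case True
    then have I: "idems ?R = carrier ?R" using R_smg_idems_eq_carrier_iff[OF reg] by blast
    have "carrier ?R \<noteq> {}" using R by (simp add: semigrp_def)
    then show ?thesis
      using True I one two R_smg_semiband[OF reg]
      by (simp add: has_depth_def flip: numeral_2_eq_2)
  next
    case False
    then have "idems ?R \<noteq> carrier ?R" using R_smg_idems_eq_carrier_iff[OF reg] by blast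
    then show ?thesis
      using False two three R_smg_semiband[OF reg] by (simp add: has_depth_def)
  qed
qed

lemma diagonal_embedding:
  assumes reg: "regular_semigrp S"
  shows "smg_embedding (\<lambda>s. (s, s, sigma)) S (R_smg S)"
proof -
  have "mult (R_smg S) = TR2_mult S" by (simp add: R_smg_def)
  then show ?thesis
    using green_L_refl by (auto simp: smg_embedding_def R_smg_carrier[OF reg] inj_on_def)
qed

theorem proposition5p2:
  fixes S :: "'a smg"
  assumes "regular_semigrp S"
  shows "regular_semigrp (R_smg S) \<and> semiband (R_smg S) \<and>
         (\<not> band S \<longrightarrow> has_depth (R_smg S) 2) \<and>
         (band S \<longrightarrow> has_depth (R_smg S) 1) \<and>
         smg_embedding (\<lambda>s. (s, s, sigma)) S (R_smg S) \<and>
         (\<forall>K \<in> {green_H, green_L, green_R, green_D, green_J}.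
            K (T_smg S) \<inter> (carrier (R_smg S) \<times> carrier (R_smg S)) = K (R_smg S)) \<and>
         natural_order (T_smg S) \<inter> (carrier (R_smg S) \<times> carrier (R_smg S))
           = natural_order (R_smg S)"
proof -
  interpret regular_right_ideal "T_smg S" "R_smg S"
    by (rule R_smg_regular_right_ideal[OF assms])
  have "\<forall>K \<in> {green_H, green_L, green_R, green_D, green_J}.
      K (T_smg S) \<inter> (carrier (R_smg S) \<times> carrier (R_smg S)) = K (R_smg S)"
    by (simp add: green_H_restrict green_L_restrict green_R_restrict green_D_restrict green_J_restrict)
  then show ?thesis
    using R_smg_regular[OF assms] R_smg_semiband[OF assms] R_smg_depth[OF assms]
      diagonal_embedding[OF assms] natural_order_restrict
    by auto
qed

end
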